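(* For every $n\ge 3$, $f(n,3,\{\wedge_2,\vee_2,P_3\})=2^{n-2}$.
   Context: $B_n$ is the Boolean lattice $2^{[n]}$ ordered by inclusion. For a finite poset $P$, a family $\mathcal G\subseteq B_n$ is a (strong) copy of $P$ if there is a bijection $i:P\to\mathcal G$ with $p\le_P q$ if and only if $i(p)\subseteq i(q)$ (for $p\neq q$, strictly). For a partial coloring $c$ of $B_n$, a copy is rainbow if all its members are colored and receive pairwise distinct colors. For a positive integer $l$ and a family $\mathcal P$ of finite posets, $f(n,l,\mathcal P)$ is the maximum $m$ such that there exists a partial coloring $c$ of $B_n$ with colors from $[l]$ admitting no rainbow strong copy of any $P\in\mathcal P$ and with every color class $c^{-1}(\{i\})$, $i\in[l]$, of size at least $m$. $P_3$ is the chain (totally ordered set) on $3$ elements; $\vee_2$ is the poset on elements $a,b_1,b_2$ with $a<b_1$, $a<b_2$ and $b_1,b_2$ incomparable; $\wedge_2$ is the poset on $a,b_1,b_2$ with $b_1<a$, $b_2<a$ and $b_1,b_2$ incomparable. *)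

theory Defs
  imports Main
begin

text \<open>
  A poset is a relation \<open>r\<close> with \<^prop>\<open>Partial_order r\<close>: the weak (reflexive) order
  as a set of pairs, whose underlying set is \<^term>\<open>Field r\<close>.
\<close>

definition P3 :: "nat rel" where
  "P3 = {(0, 0), (1, 1), (2, 2), (0, 1), (1, 2), (0, 2)}"

text \<open>In \<open>vee2\<close> and \<open>wedge2\<close> the element \<open>a\<close> is 0, and \<open>b\<^sub>1\<close>, \<open>b\<^sub>2\<close> are 1 and 2.\<close>

definition vee2 :: "nat rel" where
  "vee2 = {(0, 0), (1, 1), (2, 2), (0, 1), (0, 2)}"

definition wedge2 :: "nat rel" where
  "wedge2 = {(0, 0), (1, 1), (2, 2), (1, 0), (2, 0)}"

lemma Field_P3: "Field P3 = {0, 1, 2}"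
  and Field_vee2: "Field vee2 = {0, 1, 2}"
  and Field_wedge2: "Field wedge2 = {0, 1, 2}"
  by (auto simp: P3_def vee2_def wedge2_def Field_def Domain_iff Range_iff)

lemma Linear_order_P3: "Linear_order P3"
  unfolding linear_order_on_def partial_order_on_def preorder_on_def Field_P3
  by (auto simp: P3_def refl_on_def trans_def antisym_def total_on_def)

lemma Partial_order_vee2: "Partial_order vee2"
  unfolding partial_order_on_def preorder_on_def Field_vee2
  by (auto simp: vee2_def refl_on_def trans_def antisym_def)

lemma Partial_order_wedge2: "Partial_order wedge2"
  unfolding partial_order_on_def preorder_on_def Field_wedge2
  by (auto simp: wedge2_def refl_on_def trans_def antisym_def)

definition Boolean_lattice :: "nat \<Rightarrow> nat set set" where
  "Boolean_lattice n = Pow {1..n}"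

definition strong_copy :: "nat \<Rightarrow> 'a rel \<Rightarrow> nat set set \<Rightarrow> bool" where
  "strong_copy n P G \<longleftrightarrow> G \<subseteq> Boolean_lattice n \<and>
     (\<exists>i. bij_betw i (Field P) G \<and>
          (\<forall>p \<in> Field P. \<forall>q \<in> Field P. (p, q) \<in> P \<longleftrightarrow> i p \<subseteq> i q))"

definition partial_coloring :: "nat \<Rightarrow> nat \<Rightarrow> (nat set \<rightharpoonup> nat) \<Rightarrow> bool" where
  "partial_coloring n l c \<longleftrightarrow> dom c \<subseteq> Boolean_lattice n \<and> ran c \<subseteq> {1..l}"

definition rainbow :: "(nat set \<rightharpoonup> nat) \<Rightarrow> nat set set \<Rightarrow> bool" where
  "rainbow c G \<longleftrightarrow> G \<subseteq> dom c \<and> inj_on c G"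

definition color_class :: "(nat set \<rightharpoonup> nat) \<Rightarrow> nat \<Rightarrow> nat set set" where
  "color_class c i = {A. c A = Some i}"

definition rainbow_free :: "nat \<Rightarrow> 'a rel set \<Rightarrow> (nat set \<rightharpoonup> nat) \<Rightarrow> bool" where
  "rainbow_free n \<P> c \<longleftrightarrow> (\<forall>P \<in> \<P>. \<forall>G. strong_copy n P G \<longrightarrow> \<not> rainbow c G)"

definition attainable :: "nat \<Rightarrow> nat \<Rightarrow> 'a rel set \<Rightarrow> nat set" where
  "attainable n l \<P> =
     {m. \<exists>c. partial_coloring n l c \<and> rainbow_free n \<P> c \<and>
             (\<forall>i \<in> {1..l}. m \<le> card (color_class c i))}"

definition f :: "nat \<Rightarrow> nat \<Rightarrow> 'a rel set \<Rightarrow> nat" where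
  "f n l \<P> = Max (attainable n l \<P>)"

text \<open>
  The maximum is taken over a finite nonempty set as soon as there is at least one color
  and the forbidden posets are nonempty.
\<close>

lemma finite_attainable:
  assumes "l \<ge> 1"
  shows "finite (attainable n l \<P>)"
proof (rule finite_subset)
  show "attainable n l \<P> \<subseteq> {..card (Boolean_lattice n)}"
  proof
    fix m assume "m \<in> attainable n l \<P>"
    then obtain c where c: "partial_coloring n l c" "\<forall>i \<in> {1..l}. m \<le> card (color_class c i)"
      by (auto simp: attainable_def)
    have "color_class c 1 \<subseteq> Boolean_lattice n"
      using c(1) by (auto simp: partial_coloring_def color_class_def)
    moreover have "finite (Boolean_lattice n)"
      by (simp add: Boolean_lattice_def)
    ultimately have "card (color_class c 1) \<le> card (Boolean_lattice n)"
      by (rule card_mono[rotated])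
    moreover have "m \<le> card (color_class c 1)"
      using c(2) assms by simp
    ultimately show "m \<in> {..card (Boolean_lattice n)}"
      by simp
  qed
qed simp

lemma zero_in_attainable:
  assumes "{} \<notin> \<P>"
  shows "0 \<in> attainable n l \<P>"
proof -
  have "rainbow_free n \<P> Map.empty"
    unfolding rainbow_free_def
  proof (intro ballI allI impI)
    fix P G assume P: "P \<in> \<P>" and G: "strong_copy n P G"
    have "Field P \<noteq> {}"
      using P assms by (metis Field_empty Field_def Domain_empty_iff Un_empty)
    then have "G \<noteq> {}"
      using G by (auto simp: strong_copy_def bij_betw_def)
    then show "\<not> rainbow Map.empty G"
      by (simp add: rainbow_def)
  qed
  moreover have "partial_coloring n l Map.empty"
    by (simp add: partial_coloring_def)
  ultimately show ?thesis
    by (auto simp: attainable_def)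
qed

end

theory Submission
  imports Defs
begin

text \<open>
  A rainbow copy of one of the three posets is a triple of differently coloured sets, one of
  which is comparable to the other two. So in a rainbow-free colouring every coloured set is
  incomparable to all sets of one of the two other colours. If \<open>A\<close>, \<open>B\<close>, \<open>C\<close> are the colour
  classes, then the members of \<open>A \<union> B\<close> that are incomparable to all of \<open>C\<close> form a family
  cross-incomparable to \<open>C\<close>, and the three families obtained in this way cover
  \<open>A \<union> B \<union> C\<close>. By Kleitman's correlation inequality and AM-GM, of two cross-incomparable
  families one has at most \<open>2 ^ (n - 2)\<close> members; so if all classes were larger than that, their
  sizes would add up to at most \<open>3 * 2 ^ (n - 2)\<close>, a contradiction. Equality is attained by
  colouring a set according to its trace on \<open>{1, 2, 3}\<close>: the six nontrivial traces form a
  hexagon under comparability, coloured 1, 1, 2, 2, 3, 3 cyclically.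
\<close>

section \<open>Kleitman's correlation inequality for an up-set and a down-set\<close>

lemma inj_on_insert_Pow: "x \<notin> S \<Longrightarrow> inj_on (insert x) (Pow S)"
  by (rule inj_on_inverseI[where g = "\<lambda>A. A - {x}"]) auto

lemma card_Pow_insert_split:
  assumes "finite S" "x \<notin> S" "F \<subseteq> Pow (insert x S)"
  shows "card F = card {A \<in> Pow S. A \<in> F} + card {A \<in> Pow S. insert x A \<in> F}"
proof -
  let ?F0 = "{A \<in> Pow S. A \<in> F}" and ?F1 = "{A \<in> Pow S. insert x A \<in> F}"
  have "F \<subseteq> ?F0 \<union> insert x ` ?F1"
  proof
    fix A assume A: "A \<in> F"
    show "A \<in> ?F0 \<union> insert x ` ?F1"
    proof (cases "x \<in> A")
      case True
      then have "A = insert x (A - {x})" by blast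
      moreover from this have "A - {x} \<in> ?F1" using A assms(3) by auto
      ultimately show ?thesis by blast
    next
      case False
      then show ?thesis using A assms(3) by blast
    qed
  qed
  then have "F = ?F0 \<union> insert x ` ?F1" by blast
  then have "card F = card (?F0 \<union> insert x ` ?F1)" by (rule arg_cong)
  also have "\<dots> = card ?F0 + card (insert x ` ?F1)"
    using assms(1,2) by (intro card_Un_disjoint) auto
  also have "card (insert x ` ?F1) = card ?F1"
    by (rule card_image, rule inj_on_subset[OF inj_on_insert_Pow[OF assms(2)]]) blast
  finally show ?thesis .
qed

text \<open>Induction on the ground set: the sections of \<open>U\<close> and \<open>D\<close> at a
  new point \<open>x\<close> are again an up-set and a down-set of \<open>Pow S\<close>. The two
  bounds from the induction hypothesis combine by a Chebyshev-type inequality, since the section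
  sizes of \<open>U\<close> and \<open>D\<close> are oppositely ordered.\<close>

theorem Kleitman_correlation:
  assumes "finite S" "U \<subseteq> Pow S" "D \<subseteq> Pow S"
    and "\<And>A B. A \<in> U \<Longrightarrow> A \<subseteq> B \<Longrightarrow> B \<subseteq> S \<Longrightarrow> B \<in> U"
    and "\<And>A B. B \<in> D \<Longrightarrow> A \<subseteq> B \<Longrightarrow> A \<in> D"
  shows "card (U \<inter> D) * 2 ^ card S \<le> card U * card D"
  using assms
proof (induction S arbitrary: U D rule: finite_induct)
  case empty
  then have "U = {} \<or> U = {{}}" "D = {} \<or> D = {{}}" by auto
  then show ?case by auto
next
  case (insert x S)
  let ?r0 = "\<lambda>F. {A \<in> Pow S. A \<in> F}" and ?r1 = "\<lambda>F. {A \<in> Pow S. insert x A \<in> F}"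
  note split = card_Pow_insert_split[OF insert.hyps(1,2)]
  have up: "B \<in> U" if "A \<in> U" "A \<subseteq> B" "B \<subseteq> insert x S" for A B
    using insert.prems(3) that by blast
  have down: "A \<in> D" if "B \<in> D" "A \<subseteq> B" for A B
    using insert.prems(4) that by blast
  have "card (?r0 U \<inter> ?r0 D) * 2 ^ card S \<le> card (?r0 U) * card (?r0 D)"
    by (rule insert.IH) (auto intro: up down)
  moreover have "?r0 U \<inter> ?r0 D = ?r0 (U \<inter> D)" by blast
  ultimately have IH0: "card (?r0 (U \<inter> D)) * 2 ^ card S \<le> card (?r0 U) * card (?r0 D)"
    by simp
  have "card (?r1 U \<inter> ?r1 D) * 2 ^ card S \<le> card (?r1 U) * card (?r1 D)"
    by (rule insert.IH) (auto intro: up[OF _ insert_mono] down[OF _ insert_mono])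
  moreover have "?r1 U \<inter> ?r1 D = ?r1 (U \<inter> D)" by blast
  ultimately have IH1: "card (?r1 (U \<inter> D)) * 2 ^ card S \<le> card (?r1 U) * card (?r1 D)"
    by simp
  \<comment> \<open>Adding \<open>x\<close> keeps a set in the up-set \<open>U\<close>, and removing
    it keeps a set in the down-set \<open>D\<close>; so both differences \<open>u\<close> and
    \<open>d\<close> are natural numbers.\<close>
  have "card (?r0 U) \<le> card (?r1 U)"
    using insert.hyps(1) by (intro card_mono) (auto intro: up)
  then obtain u where u: "card (?r1 U) = card (?r0 U) + u" using le_Suc_ex by blast
  have "card (?r1 D) \<le> card (?r0 D)"
    using insert.hyps(1) by (intro card_mono) (auto intro: down)
  then obtain d where d: "card (?r0 D) = card (?r1 D) + d" using le_Suc_ex by blast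
  have "card (U \<inter> D) * 2 ^ card (insert x S)
      = 2 * (card (?r0 (U \<inter> D)) * 2 ^ card S + card (?r1 (U \<inter> D)) * 2 ^ card S)"
    using insert.hyps split[of "U \<inter> D"] le_infI1[OF insert.prems(1)]
    by (simp add: algebra_simps)
  also have "\<dots> \<le> 2 * (card (?r0 U) * card (?r0 D) + card (?r1 U) * card (?r1 D))"
    using IH0 IH1 by simp
  \<comment> \<open>The right side exceeds the left by exactly \<open>u * d\<close>.\<close>
  also have "\<dots> \<le> (card (?r0 U) + card (?r1 U)) * (card (?r0 D) + card (?r1 D))"
    unfolding u d by (simp add: algebra_simps)
  also have "\<dots> = card U * card D"
    using split[of U] split[of D] insert.prems(1,2) by simp
  finally show ?case .
qed

section \<open>Sizes of cross-incomparable families\<close>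

abbreviation comparable :: "'a set \<Rightarrow> 'a set \<Rightarrow> bool" where
  "comparable A B \<equiv> A \<subseteq> B \<or> B \<subseteq> A"

lemma four_mult_le_square:
  fixes x y :: int
  assumes "x + y = k"
  shows "4 * (x * y) \<le> k * k"
proof -
  have "k * k - 4 * (x * y) = (x - y) * (x - y)"
    unfolding assms[symmetric] by (simp add: algebra_simps)
  then show ?thesis using zero_le_square[of "x - y"] by linarith
qed

text \<open>Let \<open>U\<close> and \<open>D\<close> be the up-set and the down-set generated by
  \<open>F\<close>. Then \<open>F\<close> lies in both and \<open>G\<close> in neither, so
  Kleitman's inequality bounds \<open>F\<close> by \<open>U\<close> and \<open>D\<close>, and
  \<open>G\<close> by their complements. In the product of the two bounds each family meets its own
  complement, and AM-GM applies to each pair.\<close>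

lemma cross_incomparable_card:
  assumes S: "finite S" "F \<subseteq> Pow S" "G \<subseteq> Pow S"
    and inc: "\<And>A B. A \<in> F \<Longrightarrow> B \<in> G \<Longrightarrow> \<not> comparable A B"
  shows "4 * card F \<le> 2 ^ card S \<or> 4 * card G \<le> 2 ^ card S"
proof (rule ccontr)
  define N :: nat where "N = 2 ^ card S"
  define U where "U = {B \<in> Pow S. \<exists>A\<in>F. A \<subseteq> B}"
  define D where "D = {B \<in> Pow S. \<exists>A\<in>F. B \<subseteq> A}"
  assume "\<not> ?thesis"
  then have large: "N < 4 * card F" "N < 4 * card G" by (simp_all add: N_def)
  have finP: "finite (Pow S)" using S(1) by simp
  have UD: "U \<subseteq> Pow S" "D \<subseteq> Pow S" unfolding U_def D_def by blast+
  have "card F \<le> card (U \<inter> D)"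
    using S finP UD by (intro card_mono) (auto simp: U_def D_def intro: finite_subset)
  moreover have "card (U \<inter> D) * N \<le> card U * card D"
    unfolding N_def
    by (rule Kleitman_correlation[OF S(1) UD])
      (auto simp: U_def D_def; meson order_trans)+
  ultimately have "card F * N \<le> card U * card D"
    by (meson le_trans mult_le_mono1)
  then have F_le: "int (card F) * int N \<le> int (card U) * int (card D)"
    by (simp flip: of_nat_mult)
  \<comment> \<open>Complementation swaps the roles: \<open>Pow S - D\<close> is now the up-set and
    \<open>Pow S - U\<close> the down-set.\<close>
  have "G \<subseteq> (Pow S - D) \<inter> (Pow S - U)"
    using S(3) inc by (auto simp: U_def D_def)
  then have "card G \<le> card ((Pow S - D) \<inter> (Pow S - U))"
    using finP by (intro card_mono) auto
  moreover have "card ((Pow S - D) \<inter> (Pow S - U)) * N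
      \<le> card (Pow S - D) * card (Pow S - U)"
    unfolding N_def
    by (rule Kleitman_correlation[OF S(1)])
      (auto simp: U_def D_def; meson order_trans)+
  ultimately have "card G * N \<le> card (Pow S - D) * card (Pow S - U)"
    by (meson le_trans mult_le_mono1)
  then have G_le: "int (card G) * int N \<le> int (card (Pow S - D)) * int (card (Pow S - U))"
    by (simp flip: of_nat_mult)
  have "card (Pow S) = N" using S(1) by (simp add: N_def card_Pow)
  then have compl: "card U + card (Pow S - U) = N" "card D + card (Pow S - D) = N"
    using UD finP
    by (metis card_Diff_subset card_mono finite_subset le_add_diff_inverse)+
  define u d u' d' where defs: "u = int (card U)" "d = int (card D)"
    "u' = int (card (Pow S - U))" "d' = int (card (Pow S - D))"
  define M where "M = int N"
  have pos: "M > 0" "0 \<le> u" "0 \<le> u'" "0 \<le> d" "0 \<le> d'"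
    by (simp_all add: M_def N_def defs)
  have "M * M < 4 * int (card F) * M" "M * M < 4 * int (card G) * M"
    using large pos(1) by (auto simp: M_def)
  then have lower: "M * M < 4 * (u * d)" "M * M < 4 * (d' * u')"
    using F_le G_le unfolding defs M_def by linarith+
  have "u + u' = M" "d + d' = M"
    using compl by (simp_all add: defs M_def flip: of_nat_add)
  then have upper: "4 * (u * u') \<le> M * M" "4 * (d * d') \<le> M * M"
    by (simp_all add: four_mult_le_square)
  have MM: "0 < M * M" using pos(1) by simp
  \<comment> \<open>Multiplying the lower bounds allows regrouping \<open>u\<close> with
    \<open>u'\<close> and \<open>d\<close> with \<open>d'\<close>.\<close>
  have "(M * M) * (M * M) < (4 * (u * d)) * (4 * (d' * u'))"
    by (rule mult_strict_mono) (use MM lower in linarith)+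
  also have "\<dots> = (4 * (u * u')) * (4 * (d * d'))" by (simp add: algebra_simps)
  also have "\<dots> \<le> (M * M) * (M * M)"
    by (rule mult_mono) (use upper MM pos in simp_all)
  finally show False by simp
qed

section \<open>Copies of the three posets as triples with a common comparable member\<close>

lemma strong_copyI:
  fixes P :: "nat rel"
  assumes "A \<subseteq> {1..n}" "B \<subseteq> {1..n}" "C \<subseteq> {1..n}" "A \<noteq> B" "A \<noteq> C" "B \<noteq> C"
    and Field: "Field P = {0, 1, 2}"
    and "(0, 0) \<in> P" "(1, 1) \<in> P" "(2, 2) \<in> P"
    and "(0, 1) \<in> P \<longleftrightarrow> A \<subseteq> B" "(1, 0) \<in> P \<longleftrightarrow> B \<subseteq> A" "(0, 2) \<in> P \<longleftrightarrow> A \<subseteq> C"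
    and "(2, 0) \<in> P \<longleftrightarrow> C \<subseteq> A" "(1, 2) \<in> P \<longleftrightarrow> B \<subseteq> C" "(2, 1) \<in> P \<longleftrightarrow> C \<subseteq> B"
  shows "strong_copy n P {A, B, C}"
  unfolding strong_copy_def Field
proof (intro conjI exI)
  let ?i = "\<lambda>p::nat. if p = 0 then A else if p = 1 then B else C"
  show "{A, B, C} \<subseteq> Boolean_lattice n" using assms(1-3) by (simp add: Boolean_lattice_def)
  show "bij_betw ?i {0, 1, 2} {A, B, C}"
    using assms(4-6) by (auto simp: bij_betw_def inj_on_def)
  show "\<forall>p\<in>{0, 1, 2}. \<forall>q\<in>{0, 1, 2}. (p, q) \<in> P \<longleftrightarrow> ?i p \<subseteq> ?i q"
    using assms(8-) by simp
qed

lemma strong_copy_cherry: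
  assumes "A \<subseteq> {1..n}" "B \<subseteq> {1..n}" "C \<subseteq> {1..n}" "A \<noteq> B" "A \<noteq> C" "B \<noteq> C"
    and "comparable A B" "comparable A C"
  shows "\<exists>P \<in> {wedge2, vee2, P3}. strong_copy n P {A, B, C}"
proof -
  have chain: "\<exists>P \<in> {wedge2, vee2, P3}. strong_copy n P {X, Y, Z}"
    if "X \<subseteq> Y" "Y \<subseteq> Z" "X \<noteq> Y" "Y \<noteq> Z" "Z \<subseteq> {1..n}" for X Y Z
  proof -
    have "strong_copy n P3 {X, Y, Z}"
      by (rule strong_copyI) (use that Field_P3 in \<open>auto simp: P3_def\<close>)
    then show ?thesis by blast
  qed
  have perm: "{A, C, B} = {A, B, C}" "{B, A, C} = {A, B, C}" "{B, C, A} = {A, B, C}"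
    "{C, A, B} = {A, B, C}" "{C, B, A} = {A, B, C}" by blast+
  \<comment> \<open>If \<open>A\<close> lies between \<open>B\<close> and \<open>C\<close>,
    transitivity puts the triple in the first case; otherwise \<open>A\<close> is below both or
    above both.\<close>
  consider "comparable B C" | "A \<subseteq> B" "A \<subseteq> C" "\<not> comparable B C"
    | "B \<subseteq> A" "C \<subseteq> A" "\<not> comparable B C"
    using assms(7,8) by blast
  then show ?thesis
  proof cases
    case 1
    then consider "A \<subseteq> B" "B \<subseteq> C" | "A \<subseteq> C" "C \<subseteq> B" | "B \<subseteq> A" "A \<subseteq> C"
      | "B \<subseteq> C" "C \<subseteq> A" | "C \<subseteq> A" "A \<subseteq> B" | "C \<subseteq> B" "B \<subseteq> A"
      using assms(7,8) by blast
    then show ?thesis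
      using assms(1-6) chain[of A B C] chain[of A C B] chain[of B A C] chain[of B C A]
        chain[of C A B] chain[of C B A] unfolding perm by cases simp_all
  next
    case 2
    have "strong_copy n vee2 {A, B, C}"
      by (rule strong_copyI) (use 2 assms Field_vee2 in \<open>auto simp: vee2_def\<close>)
    then show ?thesis by blast
  next
    case 3
    have "strong_copy n wedge2 {A, B, C}"
      by (rule strong_copyI) (use 3 assms Field_wedge2 in \<open>auto simp: wedge2_def\<close>)
    then show ?thesis by blast
  qed
qed

text \<open>In each of the three posets the element 0 is comparable to 1 and 2, so its image serves
  as \<open>A\<close>.\<close>

lemma strong_copy_cherryE:
  assumes "strong_copy n P G" "P \<in> {wedge2, vee2, P3}"
  obtains A B C where "G = {A, B, C}" "A \<noteq> B" "A \<noteq> C" "B \<noteq> C" "comparable A B" "comparable A C"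
proof -
  have Field: "Field P = {0, 1, 2}"
    using assms(2) Field_P3 Field_vee2 Field_wedge2 by auto
  obtain i where bij: "bij_betw i {0, 1, 2} G"
    and i: "\<forall>p\<in>{0, 1, 2}. \<forall>q\<in>{0, 1, 2}. (p, q) \<in> P \<longleftrightarrow> i p \<subseteq> i q"
    using assms(1) unfolding strong_copy_def Field by blast
  have G: "G = {i 0, i 1, i 2}" and ne: "i 0 \<noteq> i 1" "i 0 \<noteq> i 2" "i 1 \<noteq> i 2"
    using bij by (auto simp: bij_betw_def inj_on_def)
  have "((0, 1) \<in> P \<or> (1, 0) \<in> P) \<and> ((0, 2) \<in> P \<or> (2, 0) \<in> P)"
    using assms(2) by (auto simp: P3_def vee2_def wedge2_def)
  then show ?thesis using i by (intro that[OF G ne]) simp_all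
qed

text \<open>Reduces the three forbidden posets to one condition on coloured triples, which both
  bounds use in place of copies.\<close>

lemma rainbow_free_iff:
  assumes "dom c \<subseteq> Boolean_lattice n"
  shows "rainbow_free n {wedge2, vee2, P3} c \<longleftrightarrow>
    (\<forall>A\<in>dom c. \<forall>B\<in>dom c. \<forall>C\<in>dom c. comparable A B \<longrightarrow> comparable A C \<longrightarrow>
      c A = c B \<or> c A = c C \<or> c B = c C)" (is "?L \<longleftrightarrow> ?R")
proof
  assume L: ?L
  show ?R
  proof (intro ballI impI, rule ccontr)
    fix A B C assume dom: "A \<in> dom c" "B \<in> dom c" "C \<in> dom c"
      and comp: "comparable A B" "comparable A C"
      and "\<not> (c A = c B \<or> c A = c C \<or> c B = c C)"
    then have col: "c A \<noteq> c B" "c A \<noteq> c C" "c B \<noteq> c C" by auto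
    have "\<exists>P \<in> {wedge2, vee2, P3}. strong_copy n P {A, B, C}"
      using dom comp col assms
      by (intro strong_copy_cherry) (auto simp: Boolean_lattice_def)
    moreover have "rainbow c {A, B, C}"
      using dom col by (auto simp: rainbow_def inj_on_def)
    ultimately show False using L unfolding rainbow_free_def by blast
  qed
next
  assume R: ?R
  show ?L
    unfolding rainbow_free_def
  proof (intro ballI allI impI notI)
    fix P G assume "P \<in> {wedge2, vee2, P3}" "strong_copy n P G" and r: "rainbow c G"
    then obtain A B C where G: "G = {A, B, C}" "A \<noteq> B" "A \<noteq> C" "B \<noteq> C"
      and comp: "comparable A B" "comparable A C"
      by (metis strong_copy_cherryE)
    have "A \<in> dom c" "B \<in> dom c" "C \<in> dom c" "c A \<noteq> c B" "c A \<noteq> c C" "c B \<noteq> c C"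
      using r G by (auto simp: rainbow_def inj_on_def)
    then show False using R comp by blast
  qed
qed

section \<open>The upper bound\<close>

lemma attainable_le:
  assumes "n \<ge> 2" "m \<in> attainable n 3 {wedge2, vee2, P3}"
  shows "m \<le> 2 ^ (n - 2)"
proof (rule ccontr)
  assume "\<not> ?thesis"
  moreover have four: "4 * 2 ^ (n - 2) = (2 :: nat) ^ n"
  proof -
    obtain k where "n = 2 + k" using assms(1) le_Suc_ex by blast
    then show ?thesis by (simp add: power_add)
  qed
  ultimately have m: "(2 :: nat) ^ n < 4 * m" by linarith
  obtain c where c: "partial_coloring n 3 c" "rainbow_free n {wedge2, vee2, P3} c"
    and large: "\<And>i. i \<in> {1..3} \<Longrightarrow> m \<le> card (color_class c i)"
    using assms(2) unfolding attainable_def by blast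
  have dom: "dom c \<subseteq> Boolean_lattice n" using c(1) by (simp add: partial_coloring_def)
  define K where "K = color_class c"
  define X where "X i k = {A \<in> K i. \<forall>B\<in>K k. \<not> comparable A B}" for i k
  have K_sub: "K i \<subseteq> Pow {1..n}" for i
    using dom by (auto simp: K_def color_class_def Boolean_lattice_def)
  have finK: "finite (K i)" for i
    using K_sub finite_subset by blast
  have finX: "finite (X i k)" for i k
    using finK by (simp add: X_def)
  have disj: "K i \<inter> K j = {}" if "i \<noteq> j" for i j
    using that by (auto simp: K_def color_class_def)
  have pair: "4 * (card (X i k) + card (X j k)) \<le> 2 ^ n"
    if "i \<noteq> j" "k \<in> {1..3}" for i j k
  proof -
    \<comment> \<open>\<open>X i k\<close> and \<open>X j k\<close> together are cross-incomparable
      to \<open>K k\<close>. As \<open>K k\<close> is too large for the second alternative, the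
      first must hold.\<close>
    have "4 * card (X i k \<union> X j k) \<le> 2 ^ card {1..n} \<or> 4 * card (K k) \<le> 2 ^ card {1..n}"
      using K_sub by (intro cross_incomparable_card) (auto simp: X_def)
    moreover have "2 ^ n < 4 * card (K k)"
      using m large[OF that(2)] unfolding K_def by linarith
    moreover have "X i k \<inter> X j k = {}"
      using disj[OF that(1)] by (auto simp: X_def)
    then have "card (X i k \<union> X j k) = card (X i k) + card (X j k)"
      using finX by (intro card_Un_disjoint) auto
    ultimately show ?thesis by simp
  qed
  have cover: "m \<le> card (X i j) + card (X i k)"
    if "i \<noteq> j" "i \<noteq> k" "j \<noteq> k" "i \<in> {1..3}" for i j k
  proof -
    \<comment> \<open>A set of \<open>K i\<close> outside both would have comparable sets in
      \<open>K j\<close> and in \<open>K k\<close>, forming a forbidden rainbow triple.\<close>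
    have "K i \<subseteq> X i j \<union> X i k"
    proof
      fix A assume A: "A \<in> K i"
      show "A \<in> X i j \<union> X i k"
      proof (rule ccontr)
        assume "A \<notin> X i j \<union> X i k"
        then obtain B C where BC: "B \<in> K j" "comparable A B" "C \<in> K k" "comparable A C"
          using A unfolding X_def by blast
        then have "c A = Some i" "c B = Some j" "c C = Some k"
          using A by (simp_all add: K_def color_class_def)
        moreover from this have "A \<in> dom c" "B \<in> dom c" "C \<in> dom c" by auto
        ultimately show False
          using c(2) BC(2,4) that(1-3) unfolding rainbow_free_iff[OF dom]
          by (metis option.inject)
      qed
    qed
    then have "card (K i) \<le> card (X i j \<union> X i k)"
      using finX by (intro card_mono) auto
    also have "\<dots> \<le> card (X i j) + card (X i k)" by (rule card_Un_le)
    finally show ?thesis using large[OF that(4)] unfolding K_def by linarith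
  qed
  define x where "x i k = card (X i k)" for i k
  have "4 * x 1 3 + 4 * x 2 3 \<le> 2 ^ n" "4 * x 1 2 + 4 * x 3 2 \<le> 2 ^ n"
    "4 * x 2 1 + 4 * x 3 1 \<le> 2 ^ n"
    using pair[of 1 2 3] pair[of 1 3 2] pair[of 2 3 1] by (auto simp: x_def)
  moreover have "m \<le> x 1 2 + x 1 3" "m \<le> x 2 1 + x 2 3" "m \<le> x 3 1 + x 3 2"
    by (simp_all add: cover x_def)
  \<comment> \<open>Each of the six numbers \<open>x i k\<close> with distinct indices occurs once
    in the three pair bounds and once in the three cover bounds.\<close>
  ultimately have "12 * m \<le> 3 * 2 ^ n" by linarith
  then show False using m by linarith
qed

section \<open>The extremal colouring\<close>

text \<open>The three colour conditions exclude each other, so the order of the tests is immaterial.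
  Only subsets of \<open>{1..n}\<close> with trace empty or \<open>{1, 2, 3}\<close> stay
  uncoloured.\<close>

definition hexagon_coloring :: "nat \<Rightarrow> nat set \<rightharpoonup> nat" where
  "hexagon_coloring n A =
    (if \<not> A \<subseteq> {1..n} then None
     else if 1 \<in> A \<and> 3 \<notin> A then Some 1
     else if 2 \<in> A \<and> 1 \<notin> A then Some 2
     else if 3 \<in> A \<and> 2 \<notin> A then Some 3
     else None)"

lemma card_mem_nonmem:
  assumes "finite S" "a \<in> S" "b \<in> S" "a \<noteq> b"
  shows "card {A. A \<subseteq> S \<and> a \<in> A \<and> b \<notin> A} = 2 ^ (card S - 2)"
proof -
  have "A \<in> insert a ` Pow (S - {a, b})" if "A \<subseteq> S" "a \<in> A" "b \<notin> A" for A
    using that by (intro image_eqI[of _ _ "A - {a}"]) auto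
  then have "{A. A \<subseteq> S \<and> a \<in> A \<and> b \<notin> A} = insert a ` Pow (S - {a, b})"
    using assms by auto
  moreover have "inj_on (insert a) (Pow (S - {a, b}))"
    by (rule inj_on_insert_Pow) simp
  moreover have "card (S - {a, b}) = card S - 2"
    using assms by (simp add: card_Diff_subset)
  ultimately show ?thesis using assms(1) by (simp add: card_image card_Pow)
qed

lemma hexagon_coloring_class:
  "color_class (hexagon_coloring n) 1 = {A. A \<subseteq> {1..n} \<and> 1 \<in> A \<and> 3 \<notin> A}"
  "color_class (hexagon_coloring n) 2 = {A. A \<subseteq> {1..n} \<and> 2 \<in> A \<and> 1 \<notin> A}"
  "color_class (hexagon_coloring n) 3 = {A. A \<subseteq> {1..n} \<and> 3 \<in> A \<and> 2 \<notin> A}"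
  by (auto simp: color_class_def hexagon_coloring_def dest: subsetD split: if_splits)

text \<open>Comparable sets have comparable traces on \<open>{1, 2, 3}\<close>. Of the two hexagon
  neighbours of a trace, one shares its colour and the other supplies \<open>j\<close>.\<close>

lemma hexagon_coloring_neighbours:
  assumes "A \<in> dom (hexagon_coloring n)"
  obtains j where "\<And>B. B \<in> dom (hexagon_coloring n) \<Longrightarrow> comparable A B \<Longrightarrow>
    hexagon_coloring n B = Some j \<or> hexagon_coloring n B = hexagon_coloring n A"
proof -
  have A: "A \<subseteq> {1..n}" and color: "1 \<in> A \<and> 3 \<notin> A \<or> 2 \<in> A \<and> 1 \<notin> A \<or> 3 \<in> A \<and> 2 \<notin> A"
    using assms by (auto simp: hexagon_coloring_def split: if_splits del: subsetI)
  consider "1 \<in> A" "2 \<notin> A" "3 \<notin> A" | "1 \<in> A" "2 \<in> A" "3 \<notin> A" | "1 \<notin> A" "2 \<in> A" "3 \<notin> A"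
    | "1 \<notin> A" "2 \<in> A" "3 \<in> A" | "1 \<notin> A" "2 \<notin> A" "3 \<in> A" | "1 \<in> A" "2 \<notin> A" "3 \<in> A"
    using color by blast
  then show ?thesis
  proof cases
    case 1
    show ?thesis by (rule that[of 3]) (use 1 A in \<open>auto simp: hexagon_coloring_def split: if_splits del: subsetI\<close>)
  next
    case 2
    show ?thesis by (rule that[of 2]) (use 2 A in \<open>auto simp: hexagon_coloring_def split: if_splits del: subsetI\<close>)
  next
    case 3
    show ?thesis by (rule that[of 1]) (use 3 A in \<open>auto simp: hexagon_coloring_def split: if_splits del: subsetI\<close>)
  next
    case 4
    show ?thesis by (rule that[of 3]) (use 4 A in \<open>auto simp: hexagon_coloring_def split: if_splits del: subsetI\<close>)
  next
    case 5
    show ?thesis by (rule that[of 2]) (use 5 A in \<open>auto simp: hexagon_coloring_def split: if_splits del: subsetI\<close>)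
  next
    case 6
    show ?thesis by (rule that[of 1]) (use 6 A in \<open>auto simp: hexagon_coloring_def split: if_splits del: subsetI\<close>)
  qed
qed

lemma power_attainable:
  assumes "n \<ge> 3"
  shows "2 ^ (n - 2) \<in> attainable n 3 {wedge2, vee2, P3}"
proof -
  let ?c = "hexagon_coloring n"
  have dom: "dom ?c \<subseteq> Boolean_lattice n"
    by (rule subsetI) (auto simp: hexagon_coloring_def Boolean_lattice_def split: if_splits del: subsetI)
  have "ran ?c \<subseteq> {1..3}"
    by (auto simp: ran_def hexagon_coloring_def split: if_splits)
  with dom have "partial_coloring n 3 ?c" by (simp add: partial_coloring_def)
  moreover have "rainbow_free n {wedge2, vee2, P3} ?c"
    unfolding rainbow_free_iff[OF dom]
  proof (intro ballI impI)
    fix A B C assume d: "A \<in> dom ?c" "B \<in> dom ?c" "C \<in> dom ?c"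
      and comp: "comparable A B" "comparable A C"
    \<comment> \<open>\<open>B\<close> and \<open>C\<close> each have the colour of \<open>A\<close>
      or the single further colour \<open>j\<close>, so two of the three sets agree.\<close>
    show "?c A = ?c B \<or> ?c A = ?c C \<or> ?c B = ?c C"
      using hexagon_coloring_neighbours[OF d(1)] d comp by metis
  qed
  moreover have "2 ^ (n - 2) \<le> card (color_class ?c i)" if "i \<in> {1..3}" for i
  proof -
    have "i = 1 \<or> i = 2 \<or> i = 3" using that by auto
    \<comment> \<open>Here \<open>n \<ge> 3\<close> is needed for 1, 2 and 3 to belong to the ground
      set.\<close>
    then show ?thesis
      using assms card_mem_nonmem[of "{1..n}"] hexagon_coloring_class[of n] by auto
  qed
  ultimately show ?thesis unfolding attainable_def by blast
qed

theorem theorem3: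
  fixes n :: nat
  assumes "n \<ge> 3"
  shows "f n 3 {wedge2, vee2, P3} = 2 ^ (n - 2)"
  unfolding f_def
  using assms
  by (intro Max_eqI finite_attainable attainable_le power_attainable) auto

end
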